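(* Let $(\mathcal G^{\mathcal T},\theta^{\mathcal T})$ be a canonical acyclic decomposition of a graphical model $(\mathcal G,\mathcal Y_{\mathcal V},\theta)$, with $\theta^{\mathcal T}\in\Theta^{\mathcal T}$. Let $\phi\in\mathbb R^{\mathcal J}$ be such that $[\theta^\tau]^\phi$, $\tau\in\mathcal T$, are optimal reparametrizations of the slave problems with $[\theta^\tau]^\phi_u=0$ for all $\tau\in\mathcal T$ and $u\in\mathcal V^\tau$. Then $\mathcal D(\phi)=\mathcal U(\theta^{\mathcal T})$.
   Context: Graphical model: $\mathcal G=(\mathcal V,\mathcal E)$ is a finite simple undirected graph, each node $u$ has a finite non-empty label set $\mathcal Y_u$; $\mathcal Y_{uv}=\mathcal Y_u\times\mathcal Y_v$, $\mathcal Y_{\mathcal A}=\prod_{u\in\mathcal A}\mathcal Y_u$; the real cost vector $\theta$ has components $\theta_w(s)$, $w\in\mathcal V\cup\mathcal E$, $s\in\mathcal Y_w$; $y_{uv}=(y_u,y_v)$; $\mathcal N_b(u)$ is the set of neighbors of $u$. Lagrange dual: $\mathcal J=\{(u,v,s):u\in\mathcal V,\ v\in\mathcal N_b(u),\ s\in\mathcal Y_u\}$; for $\phi\in\mathbb R^{\mathcal J}$, $\theta^\phi_u(s)=\theta_u(s)-\sum_{v\in\mathcal N_b(u)}\phi_{u,v}(s)$, $\theta^\phi_{uv}(s,t)=\theta_{uv}(s,t)+\phi_{u,v}(s)+\phi_{v,u}(t)$; $\mathcal D(\phi)=\sum_{w\in\mathcal V\cup\mathcal E}\min_{s\in\mathcal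 Y_w}\theta^\phi_w(s)$. Decomposition: a finite collection of subgraphs $\mathcal G^\tau=(\mathcal V^\tau,\mathcal E^\tau)$, $\tau\in\mathcal T$, covering all nodes and edges of $\mathcal G$; $\mathcal T_w=\{\tau:w\in\mathcal V^\tau\cup\mathcal E^\tau\}$; $\Theta^{\mathcal T}$ is the set of collections $(\theta^\tau)_{\tau\in\mathcal T}$ of cost vectors on the subgraphs with $\sum_{\tau\in\mathcal T_w}\theta^\tau_w=\theta_w$ for all $w\in\mathcal V\cup\mathcal E$; $\mathcal U(\theta^{\mathcal T})=\sum_{\tau\in\mathcal T}\min_{y\in\mathcal Y_{\mathcal V^\tau}}\sum_{w\in\mathcal V^\tau\cup\mathcal E^\tau}\theta^\tau_w(y_w)$. The decomposition is canonical (acyclic) if every $\mathcal G^\tau$ is acyclic, connected and contains at least one edge, and $\mathcal E^\tau\cap\mathcal E^\sigma=\emptyset$ for $\tau\ne\sigma$. Then every edge $uv\in\mathcal E$ lies in exactly one slave subgraph, so a vector $\phi\in\mathbb R^{\mathcal J}$ is the same as a choice of reparametrization vector for every slave: $[\theta^\tau]^\phi_u(s)=\theta^\tau_u(s)-\sum_{v:\,uv\in\mathcal E^\tau}\phi_{u,v}(s)$ and $[\theta^\tau]^\phi_{uv}(s,t)=\theta^\tau_{uv}(s,t)+\phi_{u,v}(s)+\phi_{v,u}(t)$ for $uv\in\mathcal E^\tau$. The reparametrization $[\theta^\tau]^\phi$ is optimal for slave $\tau$ if it maximizes $\sum_{w\in\mathcal V^\tau\cup\mathcal E^\tau}\min_{s\in\mathcal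 Y_w}[\theta^\tau]^{\phi}_w(s)$ over all values of the components of $\phi$ attached to edges of $\mathcal E^\tau$. *)

theory Defs
  imports Complex_Main "HOL-Library.FuncSet"
begin

section \<open>Finite simple undirected graphs\<close>

record 'v ugraph =
  verts :: "'v set"
  edges :: "'v set set"

definition simple_graph :: "'v ugraph \<Rightarrow> bool" where
  "simple_graph G \<longleftrightarrow>
     finite (verts G) \<and> (\<forall>e\<in>edges G. e \<subseteq> verts G \<and> card e = 2)"

definition subgraph :: "'v ugraph \<Rightarrow> 'v ugraph \<Rightarrow> bool" where
  "subgraph H G \<longleftrightarrow>
     simple_graph H \<and> verts H \<subseteq> verts G \<and> edges H \<subseteq> edges G"

definition neighbors :: "'v ugraph \<Rightarrow> 'v \<Rightarrow> 'v set" where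
  "neighbors G u = {v. {u, v} \<in> edges G}"

definition graph_connected :: "'v ugraph \<Rightarrow> bool" where
  "graph_connected G \<longleftrightarrow>
     (\<forall>u\<in>verts G. \<forall>v\<in>verts G. (u, v) \<in> {(a, b). {a, b} \<in> edges G}\<^sup>*)"

definition is_cycle :: "'v ugraph \<Rightarrow> 'v list \<Rightarrow> bool" where
  "is_cycle G p \<longleftrightarrow>
     3 \<le> length p \<and> distinct p \<and>
     (\<forall>i<length p. {p ! i, p ! (Suc i mod length p)} \<in> edges G)"

definition graph_acyclic :: "'v ugraph \<Rightarrow> bool" where
  "graph_acyclic G \<longleftrightarrow> (\<nexists>p. is_cycle G p)"


section \<open>Graphical models and the Lagrange dual\<close>

definition graphical_model :: "'v ugraph \<Rightarrow> ('v \<Rightarrow> 'l set) \<Rightarrow> bool" where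
  "graphical_model G Y \<longleftrightarrow>
     simple_graph G \<and> (\<forall>u\<in>verts G. finite (Y u) \<and> Y u \<noteq> {})"

text \<open>
  Edges are unordered, so the label pairs of an edge \<open>e = {u, v}\<close> are represented by the
  product \<open>PiE e Y\<close> over the two endpoints: the pair \<open>(s, t)\<close> with \<open>s\<close> in \<open>Y u\<close> and \<open>t\<close> in
  \<open>Y v\<close> is the labelling \<open>x\<close> of \<open>e\<close> with \<open>x u = s\<close> and \<open>x v = t\<close>.  No orientation of the edge
  and no symmetry condition on the costs is needed.  Components of a cost vector at nodes,
  edges or labels outside the model are never inspected.
\<close>

record ('v, 'l) cost =
  unary :: "'v \<Rightarrow> 'l \<Rightarrow> real"
  pairwise :: "'v set \<Rightarrow> ('v \<Rightarrow> 'l) \<Rightarrow> real"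

definition energy :: "'v ugraph \<Rightarrow> ('v, 'l) cost \<Rightarrow> ('v \<Rightarrow> 'l) \<Rightarrow> real" where
  "energy G \<theta> y =
     (\<Sum>u\<in>verts G. unary \<theta> u (y u)) + (\<Sum>e\<in>edges G. pairwise \<theta> e (restrict y e))"

text \<open>
  A reparametrization vector is a function \<open>\<phi>\<close> whose value \<open>\<phi> u v s\<close> matters only if
  \<open>{u, v}\<close> is an edge and \<open>s\<close> is a label of \<open>u\<close>.  The sum in the pairwise component runs over
  both orderings of the endpoints of \<open>e\<close>; see \<open>pairwise_reparam_edge\<close> below.
\<close>

definition reparam ::
    "'v ugraph \<Rightarrow> ('v, 'l) cost \<Rightarrow> ('v \<Rightarrow> 'v \<Rightarrow> 'l \<Rightarrow> real) \<Rightarrow> ('v, 'l) cost" where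
  "reparam G \<theta> \<phi> =
     \<lparr> unary = (\<lambda>u s. unary \<theta> u s - (\<Sum>v\<in>neighbors G u. \<phi> u v s)),
       pairwise = (\<lambda>e x. pairwise \<theta> e x + (\<Sum>(u, v) | e = {u, v}. \<phi> u v (x u))) \<rparr>"

lemma pairwise_reparam_edge:
  assumes "u \<noteq> v"
  shows "pairwise (reparam G \<theta> \<phi>) {u, v} x =
           pairwise \<theta> {u, v} x + \<phi> u v (x u) + \<phi> v u (x v)"
proof -
  have "{(a, b). {u, v} = {a, b}} = {(u, v), (v, u)}"
    by (auto simp: doubleton_eq_iff)
  then show ?thesis
    using assms by (simp add: reparam_def)
qed

definition sum_of_minima :: "'v ugraph \<Rightarrow> ('v \<Rightarrow> 'l set) \<Rightarrow> ('v, 'l) cost \<Rightarrow> real" where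
  "sum_of_minima G Y \<theta> =
     (\<Sum>u\<in>verts G. MIN s\<in>Y u. unary \<theta> u s) +
     (\<Sum>e\<in>edges G. MIN x\<in>PiE e Y. pairwise \<theta> e x)"

definition lagrange_dual ::
    "'v ugraph \<Rightarrow> ('v \<Rightarrow> 'l set) \<Rightarrow> ('v, 'l) cost \<Rightarrow> ('v \<Rightarrow> 'v \<Rightarrow> 'l \<Rightarrow> real) \<Rightarrow> real" where
  "lagrange_dual G Y \<theta> \<phi> = sum_of_minima G Y (reparam G \<theta> \<phi>)"

text \<open>
  The dual of \<open>G\<close> depends only on the components of its reparametrization vector attached to
  edges of \<open>G\<close>.  For a subgraph \<open>G\<close> of a larger model, quantifying over all \<open>\<phi>'\<close> is therefore
  the same as varying only the components attached to the edges of the subgraph.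
\<close>

definition optimal_reparam ::
    "'v ugraph \<Rightarrow> ('v \<Rightarrow> 'l set) \<Rightarrow> ('v, 'l) cost \<Rightarrow> ('v \<Rightarrow> 'v \<Rightarrow> 'l \<Rightarrow> real) \<Rightarrow> bool" where
  "optimal_reparam G Y \<theta> \<phi> \<longleftrightarrow> (\<forall>\<phi>'. lagrange_dual G Y \<theta> \<phi>' \<le> lagrange_dual G Y \<theta> \<phi>)"


section \<open>Decompositions\<close>

definition decomposition :: "'v ugraph \<Rightarrow> 't set \<Rightarrow> ('t \<Rightarrow> 'v ugraph) \<Rightarrow> bool" where
  "decomposition G T H \<longleftrightarrow>
     finite T \<and> (\<forall>\<tau>\<in>T. subgraph (H \<tau>) G) \<and>
     verts G = (\<Union>\<tau>\<in>T. verts (H \<tau>)) \<and> edges G = (\<Union>\<tau>\<in>T. edges (H \<tau>))"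

definition canonical_decomposition :: "'v ugraph \<Rightarrow> 't set \<Rightarrow> ('t \<Rightarrow> 'v ugraph) \<Rightarrow> bool" where
  "canonical_decomposition G T H \<longleftrightarrow>
     decomposition G T H \<and>
     (\<forall>\<tau>\<in>T. graph_acyclic (H \<tau>) \<and> graph_connected (H \<tau>) \<and> edges (H \<tau>) \<noteq> {}) \<and>
     (\<forall>\<tau>\<in>T. \<forall>\<sigma>\<in>T. \<tau> \<noteq> \<sigma> \<longrightarrow> edges (H \<tau>) \<inter> edges (H \<sigma>) = {})"

definition decomposed_costs ::
    "'v ugraph \<Rightarrow> ('v \<Rightarrow> 'l set) \<Rightarrow> ('v, 'l) cost \<Rightarrow> 't set \<Rightarrow> ('t \<Rightarrow> 'v ugraph) \<Rightarrow>
     ('t \<Rightarrow> ('v, 'l) cost) set" where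
  "decomposed_costs G Y \<theta> T H = {\<theta>T.
     (\<forall>u\<in>verts G. \<forall>s\<in>Y u.
        (\<Sum>\<tau> | \<tau> \<in> T \<and> u \<in> verts (H \<tau>). unary (\<theta>T \<tau>) u s) = unary \<theta> u s) \<and>
     (\<forall>e\<in>edges G. \<forall>x\<in>PiE e Y.
        (\<Sum>\<tau> | \<tau> \<in> T \<and> e \<in> edges (H \<tau>). pairwise (\<theta>T \<tau>) e x) = pairwise \<theta> e x)}"

definition decomposition_bound ::
    "('v \<Rightarrow> 'l set) \<Rightarrow> 't set \<Rightarrow> ('t \<Rightarrow> 'v ugraph) \<Rightarrow> ('t \<Rightarrow> ('v, 'l) cost) \<Rightarrow> real" where
  "decomposition_bound Y T H \<theta>T =
     (\<Sum>\<tau>\<in>T. MIN y\<in>PiE (verts (H \<tau>)) Y. energy (H \<tau>) (\<theta>T \<tau>) y)"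

end

theory Submission
  imports Defs
begin

text \<open>
  On an acyclic graph the Lagrange dual is tight: eliminating a leaf by dynamic programming gives
  a reparametrization whose sum of minima is attained by a labelling. Hence optimality of every
  slave reparametrization makes each slave minimum equal to its sum of local minima. As edge sets
  are disjoint, each pairwise term of the master belongs to exactly one slave, while each node
  term of the master is the sum of the slave node terms, which all vanish.
\<close>

section \<open>Leaves of acyclic graphs\<close>

lemma simple_graph_edge_verts:
  assumes "simple_graph G" and "{u, v} \<in> edges G"
  shows "u \<in> verts G" and "v \<in> verts G" and "u \<noteq> v"
  using assms unfolding simple_graph_def by fastforce+

lemma simple_graph_edge_cases:
  assumes "simple_graph G" and "e \<in> edges G"
  obtains u v where "u \<noteq> v" and "e = {u, v}"
  using assms unfolding simple_graph_def by (metis card_2_iff)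

lemma finite_edges:
  assumes "simple_graph G"
  shows "finite (edges G)"
  using assms unfolding simple_graph_def
  by (auto intro: finite_subset[of _ "Pow (verts G)"])

lemma finite_neighbors:
  assumes "simple_graph G"
  shows "finite (neighbors G u)"
proof (rule finite_subset)
  show "neighbors G u \<subseteq> verts G"
    using simple_graph_edge_verts(2)[OF assms] by (auto simp: neighbors_def)
  show "finite (verts G)"
    using assms by (simp add: simple_graph_def)
qed

text \<open>The first node of a longest path is a leaf: a neighbor off the path would extend it, and
  a neighbor on the path other than the second node would close a cycle.\<close>

lemma acyclic_leaf_exists:
  assumes G: "simple_graph G" and acyclic: "graph_acyclic G" and "edges G \<noteq> {}"
  obtains u v where "neighbors G u = {v}"
proof -
  define path where "path p \<longleftrightarrow> 2 \<le> length p \<and> distinct p \<and> set p \<subseteq> verts G \<and>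
    (\<forall>i. Suc i < length p \<longrightarrow> {p ! i, p ! Suc i} \<in> edges G)" for p
  obtain a b where "{a, b} \<in> edges G"
    using \<open>edges G \<noteq> {}\<close> simple_graph_edge_cases[OF G] by (metis ex_in_conv)
  then have "path [a, b]"
    using simple_graph_edge_verts[OF G, of a b] by (simp add: path_def)
  \<comment> \<open>The nodes of a path are distinct, so lengths are bounded and a longest path
    exists.\<close>
  moreover have "length p < Suc (card (verts G))" if "path p" for p
    using that G card_mono[of "verts G" "set p"]
    by (simp add: path_def simple_graph_def distinct_card less_Suc_eq_le)
  ultimately obtain p where p: "path p" and longest: "\<And>q. path q \<Longrightarrow> length q \<le> length p"
    using ex_has_greatest_nat[of path "[a, b]" length] by metis
  from p have "2 \<le> length p"
    by (simp add: path_def)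
  then obtain u v r where p_eq: "p = u # v # r"
    by (auto simp: numeral_2_eq_2 Suc_le_length_iff)
  have "{u, v} \<in> edges G"
    using p unfolding path_def p_eq by force
  moreover have "w = v" if w: "{u, w} \<in> edges G" for w
  proof (rule ccontr)
    assume "w \<noteq> v"
    have "w \<in> verts G" and "w \<noteq> u"
      using simple_graph_edge_verts[OF G w] by auto
    show False
    proof (cases "w \<in> set p")
      case False
      have "path (w # p)"
        unfolding path_def
      proof (intro conjI allI impI)
        fix i assume i: "Suc i < length (w # p)"
        show "{(w # p) ! i, (w # p) ! Suc i} \<in> edges G"
        proof (cases i)
          case 0
          then show ?thesis
            using w by (simp add: p_eq insert_commute)
        next
          case (Suc j)
          then show ?thesis
            using p i unfolding path_def by simp
        qed
      qed (use p False \<open>w \<in> verts G\<close> in \<open>auto simp: path_def\<close>)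
      then show False
        using longest by fastforce
    next
      case True
      then obtain k where k: "k < length p" "p ! k = w"
        by (metis in_set_conv_nth)
      have "k \<noteq> 0" and "k \<noteq> 1"
        using k(2) \<open>w \<noteq> u\<close> \<open>w \<noteq> v\<close> by (auto simp: p_eq intro!: Nat.gr0I)
      then have k2: "2 \<le> k"
        by simp
      \<comment> \<open>The prefix of \<open>p\<close> from \<open>u\<close> up to \<open>w\<close>
        is closed by the edge \<open>{u, w}\<close>; \<open>2 \<le> k\<close> ensures at least three
        nodes.\<close>
      have "is_cycle G (take (Suc k) p)"
        unfolding is_cycle_def
      proof (intro conjI allI impI)
        show "distinct (take (Suc k) p)"
          using p by (simp add: path_def)
        fix i assume i: "i < length (take (Suc k) p)"
        show "{take (Suc k) p ! i,
          take (Suc k) p ! (Suc i mod length (take (Suc k) p))} \<in> edges G"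
        proof (cases "i = k")
          case True
          then have "take (Suc k) p ! i = w" and "Suc i mod length (take (Suc k) p) = 0"
            using k by simp_all
          moreover have "take (Suc k) p ! 0 = u"
            by (simp add: p_eq)
          ultimately show ?thesis
            using w by (simp add: insert_commute)
        next
          case False
          then have "Suc i < Suc k"
            using i by simp
          then show ?thesis
            using p k by (simp add: path_def)
        qed
      qed (use k k2 in simp)
      then show False
        using acyclic by (auto simp: graph_acyclic_def)
    qed
  qed
  ultimately have "neighbors G u = {v}"
    unfolding neighbors_def by blast
  then show thesis
    by (rule that)
qed

section \<open>Duality for a single graphical model\<close>

lemma finite_labellings:
  assumes "graphical_model G Y" and "A \<subseteq> verts G"
  shows "finite (PiE A Y)" and "PiE A Y \<noteq> {}"
proof -
  have "finite A"
    using assms by (auto simp: graphical_model_def simple_graph_def intro: finite_subset)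
  then show "finite (PiE A Y)"
    using assms by (intro finite_PiE) (auto simp: graphical_model_def)
  show "PiE A Y \<noteq> {}"
    using assms by (auto simp: graphical_model_def PiE_eq_empty_iff)
qed

lemma edge_subset_verts:
  assumes "graphical_model G Y" and "e \<in> edges G"
  shows "e \<subseteq> verts G"
  using assms by (auto simp: graphical_model_def simple_graph_def)

section \<open>Invariance of the energy and weak duality\<close>

lemma unary_reparam:
  "unary (reparam G \<theta> \<phi>) u s = unary \<theta> u s - (\<Sum>v\<in>neighbors G u. \<phi> u v s)"
  by (simp add: reparam_def)

lemma pairwise_reparam:
  "pairwise (reparam G \<theta> \<phi>) e x = pairwise \<theta> e x + (\<Sum>(u, v) | e = {u, v}. \<phi> u v (x u))"
  by (simp add: reparam_def)

text \<open>Each \<phi> u v (y u) is subtracted at the node \<open>u\<close> and added back at the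
  edge \<open>{u, v}\<close>. Both totals run over the ordered pairs of adjacent nodes, grouped once
  by first component and once by underlying edge.\<close>

lemma energy_reparam:
  assumes G: "simple_graph G"
  shows "energy G (reparam G \<theta> \<phi>) y = energy G \<theta> y"
proof -
  define f where "f = (\<lambda>(u, v). \<phi> u v (y u))"
  let ?A = "SIGMA u:verts G. neighbors G u"
  let ?B = "\<lambda>e. {(u, v). e = {u, v}}"
  have fin: "finite (?B e)" if "e \<in> edges G" for e
  proof (rule finite_subset)
    show "?B e \<subseteq> verts G \<times> verts G"
      using that G by (auto simp: simple_graph_def)
    show "finite (verts G \<times> verts G)"
      using G by (simp add: simple_graph_def)
  qed
  have "(\<Sum>u\<in>verts G. \<Sum>v\<in>neighbors G u. \<phi> u v (y u)) = sum f ?A"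
    unfolding f_def using G finite_neighbors[OF G]
    by (subst sum.Sigma) (auto simp: simple_graph_def)
  also have "?A = (\<Union>e\<in>edges G. ?B e)"
    using simple_graph_edge_verts[OF G] by (auto simp: neighbors_def)
  also have "sum f \<dots> = (\<Sum>e\<in>edges G. sum f (?B e))"
    using fin finite_edges[OF G] by (intro sum.UNION_disjoint) auto
  also have "\<dots> = (\<Sum>e\<in>edges G. \<Sum>(u, v) | e = {u, v}. \<phi> u v (restrict y e u))"
    unfolding f_def by (intro sum.cong) auto
  finally show ?thesis
    by (simp add: energy_def unary_reparam pairwise_reparam sum_subtractf sum.distrib)
qed

lemma sum_of_minima_le_energy:
  assumes "graphical_model G Y" and y: "y \<in> PiE (verts G) Y"
  shows "sum_of_minima G Y \<theta> \<le> energy G \<theta> y"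
  unfolding sum_of_minima_def energy_def
proof (intro add_mono sum_mono)
  fix u assume "u \<in> verts G"
  then show "(MIN s\<in>Y u. unary \<theta> u s) \<le> unary \<theta> u (y u)"
    using assms by (intro Min_le) (auto simp: graphical_model_def)
next
  fix e assume "e \<in> edges G"
  then have e: "e \<subseteq> verts G"
    by (rule edge_subset_verts[OF assms(1)])
  then have "restrict y e \<in> PiE e Y"
    using y by auto
  then show "(MIN x\<in>PiE e Y. pairwise \<theta> e x) \<le> pairwise \<theta> e (restrict y e)"
    using finite_labellings[OF assms(1) e] by (intro Min_le) auto
qed

text \<open>Weak duality: the termwise bound is applied to the reparametrized costs, whose energy is
  the original one.\<close>

lemma lagrange_dual_le_energy:
  assumes "graphical_model G Y" and "y \<in> PiE (verts G) Y"
  shows "lagrange_dual G Y \<theta> \<phi> \<le> energy G \<theta> y"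
  using sum_of_minima_le_energy[OF assms, of "reparam G \<theta> \<phi>"] assms(1)
  by (simp add: lagrange_dual_def energy_reparam graphical_model_def)

section \<open>Strong duality on forests\<close>

lemma graph_acyclic_mono:
  assumes "graph_acyclic G" and "edges H \<subseteq> edges G"
  shows "graph_acyclic H"
proof -
  have "is_cycle G p" if "is_cycle H p" for p
    using that assms(2) by (simp add: is_cycle_def subset_eq)
  then show ?thesis
    using assms(1) by (auto simp: graph_acyclic_def)
qed

text \<open>Induction on the number of edges, with the costs generalized because each step changes
  them. A leaf is minimized out, the resulting message is added to its neighbor, and the leaf edge
  is deleted. A labelling and a reparametrization for the smaller forest are then both extended to
  the leaf edge.\<close>

lemma acyclic_dual_tight:
  assumes "graphical_model G Y" and "graph_acyclic G"
  shows "\<exists>\<phi>. \<exists>y\<in>PiE (verts G) Y. energy G \<theta> y \<le> lagrange_dual G Y \<theta> \<phi>"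
  using assms
proof (induction "card (edges G)" arbitrary: G \<theta> rule: less_induct)
  case less
  have G: "simple_graph G" and Y: "\<And>u. u \<in> verts G \<Longrightarrow> finite (Y u) \<and> Y u \<noteq> {}"
    using less.prems by (auto simp: graphical_model_def)
  show ?case
  proof (cases "edges G = {}")
    case True
    have "\<exists>s\<in>Y u. unary \<theta> u s = (MIN s\<in>Y u. unary \<theta> u s)" if "u \<in> verts G" for u
      using Y[OF that] obtains_MIN[of "Y u" "unary \<theta> u"] by metis
    then obtain g where g: "\<And>u. u \<in> verts G \<Longrightarrow>
        g u \<in> Y u \<and> unary \<theta> u (g u) = (MIN s\<in>Y u. unary \<theta> u s)"
      by metis
    define y where "y = restrict g (verts G)"
    have "y \<in> PiE (verts G) Y"
      using g by (auto simp: y_def)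
    moreover have "energy G \<theta> y = lagrange_dual G Y \<theta> (\<lambda>_ _ _. 0)"
      using g True
      by (simp add: energy_def lagrange_dual_def sum_of_minima_def unary_reparam y_def)
    ultimately show ?thesis
      by (metis order_refl)
  next
    case False
    obtain u v where leaf: "neighbors G u = {v}"
      using acyclic_leaf_exists[OF G less.prems(2) False] .
    then have uv: "{u, v} \<in> edges G"
      by (auto simp: neighbors_def)
    have u: "u \<in> verts G" and v: "v \<in> verts G" and ne: "u \<noteq> v"
      using simple_graph_edge_verts[OF G uv] .
    define pair where "pair s t = restrict (\<lambda>a. if a = u then s else t) {u, v}" for s t :: 'b
    \<comment> \<open>\<open>c s t\<close> is the part of the energy that involves the leaf label
      \<open>s\<close> when \<open>v\<close> has label \<open>t\<close>; \<open>m t\<close> is its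
      minimum over \<open>s\<close>, the message from the leaf to \<open>v\<close>.\<close>
    define c where "c s t = unary \<theta> u s + pairwise \<theta> {u, v} (pair s t)" for s t
    define m where "m t = (MIN s\<in>Y u. c s t)" for t
    \<comment> \<open>The leaf stays in \<open>G'\<close> as an isolated node of cost zero, so
      labellings of \<open>G'\<close> are labellings of \<open>G\<close>.\<close>
    define G' where "G' = G\<lparr>edges := edges G - {{u, v}}\<rparr>"
    define \<theta>' where "\<theta>' = \<theta>\<lparr>unary :=
      (unary \<theta>)(u := \<lambda>_. 0, v := \<lambda>t. unary \<theta> v t + m t)\<rparr>"
    have G'_simps [simp]: "verts G' = verts G" "edges G' = edges G - {{u, v}}"
      by (simp_all add: G'_def)
    have \<theta>'_simps: "unary \<theta>' u = (\<lambda>_. 0)" "unary \<theta>' v = (\<lambda>t. unary \<theta> v t + m t)"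
      "\<And>w. w \<noteq> u \<Longrightarrow> w \<noteq> v \<Longrightarrow> unary \<theta>' w = unary \<theta> w" "pairwise \<theta>' = pairwise \<theta>"
      using ne by (auto simp: \<theta>'_def)
    have "card (edges G') < card (edges G)"
      unfolding G'_simps using finite_edges[OF G] uv by (rule card_Diff1_less)
    moreover have "graphical_model G' Y"
      using less.prems(1) by (auto simp: graphical_model_def simple_graph_def)
    moreover have "graph_acyclic G'"
      using less.prems(2) by (rule graph_acyclic_mono) auto
    ultimately obtain \<phi>' y' where y': "y' \<in> PiE (verts G) Y"
      and le: "energy G' \<theta>' y' \<le> lagrange_dual G' Y \<theta>' \<phi>'"
      using less.hyps[of G' \<theta>'] unfolding G'_simps(1) by blast
    \<comment> \<open>The leaf is relabelled by a best response to the label that \<open>y'\<close>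
      gives to \<open>v\<close>.\<close>
    obtain s where s: "s \<in> Y u" and ms: "m (y' v) = c s (y' v)"
      using Y[OF u] unfolding m_def by (metis obtains_MIN)
    define y where "y = y'(u := s)"
    \<comment> \<open>The component from \<open>u\<close> moves the whole unary cost of the leaf
      onto the edge; the component from \<open>v\<close> moves the message \<open>m\<close> from the
      edge to \<open>v\<close>. The edge cost becomes \<open>c s t - m t\<close>, which is
      nonnegative.\<close>
    define \<phi> where "\<phi> a b r =
      (if a = u \<and> b = v then unary \<theta> u r
       else if a = v \<and> b = u then - m r else \<phi>' a b r)" for a b r
    have y: "y \<in> PiE (verts G) Y"
      using y' s u by (auto simp: y_def PiE_iff extensional_def)
    have restrict_y: "restrict y {u, v} = pair s (y' v)"
      using ne by (auto simp: y_def pair_def restrict_def)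
    \<comment> \<open>The only edge at \<open>u\<close> has been deleted, so the remaining edges see
      neither the new label of \<open>u\<close> nor the new components of \<phi>.\<close>
    have other: "u \<notin> e" if "e \<in> edges G'" for e
    proof
      assume "u \<in> e"
      have "e \<in> edges G"
        using that by simp
      then obtain a b where "e = {a, b}"
        by (rule simple_graph_edge_cases[OF G])
      with \<open>u \<in> e\<close> obtain w where "e = {u, w}"
        by auto
      with that leaf show False
        by (auto simp: neighbors_def)
    qed
    have fin: "finite (verts G)" "finite (edges G)"
      using G finite_edges[OF G] by (auto simp: simple_graph_def)

    have split_verts: "(\<Sum>w\<in>verts G. f w) = f u + f v + (\<Sum>w\<in>verts G - {u, v}. f w)"
      for f :: "'a \<Rightarrow> real"
      using fin u v ne sum.subset_diff[of "{u, v}" "verts G" f] by simp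
    have split_edges: "(\<Sum>e\<in>edges G. f e) = f {u, v} + (\<Sum>e\<in>edges G'. f e)"
      for f :: "'a set \<Rightarrow> real"
      using fin uv by (simp add: sum.remove)

    have "(\<Sum>e\<in>edges G'. pairwise \<theta> e (restrict y e)) =
        (\<Sum>e\<in>edges G'. pairwise \<theta>' e (restrict y' e))"
    proof (intro sum.cong refl)
      fix e assume "e \<in> edges G'"
      then have "restrict y e = restrict y' e"
        using other[of e] by (auto simp: y_def restrict_def fun_eq_iff)
      then show "pairwise \<theta> e (restrict y e) = pairwise \<theta>' e (restrict y' e)"
        by (simp add: \<theta>'_simps)
    qed
    moreover have "(\<Sum>w\<in>verts G - {u, v}. unary \<theta> w (y w)) =
        (\<Sum>w\<in>verts G - {u, v}. unary \<theta>' w (y' w))"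
      by (intro sum.cong) (auto simp: \<theta>'_simps y_def)
    \<comment> \<open>The costs of \<open>u\<close> and of the leaf edge add up to
      \<open>c s (y' v) = m (y' v)\<close>, exactly what \<open>\<theta>'\<close> charges
      additionally at \<open>v\<close>.\<close>
    ultimately have "energy G \<theta> y = energy G' \<theta>' y'"
      using ne ms restrict_y unfolding energy_def G'_simps(1) split_verts split_edges
      by (simp add: \<theta>'_simps c_def y_def)

    have nb_u: "neighbors G' u = {}"
      using leaf by (auto simp: neighbors_def)
    have nb_v: "neighbors G v = insert u (neighbors G' v)" "u \<notin> neighbors G' v"
      using uv by (auto simp: neighbors_def insert_commute doubleton_eq_iff)
    have nb: "neighbors G' w = neighbors G w" if "w \<noteq> u" "w \<noteq> v" for w
      using that by (auto simp: neighbors_def doubleton_eq_iff)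
    have fin_nb: "finite (neighbors G' v)"
      using finite_neighbors[OF G, of v] nb_v by simp
    \<comment> \<open>After reparametrization the two models agree at all nodes and on all edges of
      \<open>G'\<close>, so their duals differ only by the minimum on the leaf edge.\<close>
    have "unary (reparam G \<theta> \<phi>) w = unary (reparam G' \<theta>' \<phi>') w" for w
    proof -
      consider "w = u" | "w = v" | "w \<noteq> u" "w \<noteq> v"
        by blast
      then show ?thesis
      proof cases
        case 1
        then show ?thesis
          by (simp add: fun_eq_iff unary_reparam leaf nb_u \<theta>'_simps \<phi>_def)
      next
        case 2
        have "(\<Sum>b\<in>neighbors G' v. \<phi> v b r) = (\<Sum>b\<in>neighbors G' v. \<phi>' v b r)" for r
          using nb_v(2) ne by (intro sum.cong) (auto simp: \<phi>_def)
        then show ?thesis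
          using 2 ne nb_v fin_nb by (simp add: fun_eq_iff unary_reparam \<theta>'_simps \<phi>_def)
      next
        case 3
        then show ?thesis
          by (simp add: fun_eq_iff unary_reparam nb \<theta>'_simps \<phi>_def)
      qed
    qed
    moreover have "pairwise (reparam G \<theta> \<phi>) e = pairwise (reparam G' \<theta>' \<phi>') e"
      if e: "e \<in> edges G'" for e
    proof -
      have "(\<Sum>(a, b) | e = {a, b}. \<phi> a b (x a)) = (\<Sum>(a, b) | e = {a, b}. \<phi>' a b (x a))" for x
        using other[OF e] by (intro sum.cong) (auto simp: \<phi>_def)
      then show ?thesis
        by (simp add: fun_eq_iff pairwise_reparam \<theta>'_simps)
    qed
    moreover have "0 \<le> (MIN x\<in>PiE {u, v} Y. pairwise (reparam G \<theta> \<phi>) {u, v} x)"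
    proof -
      have "0 \<le> pairwise (reparam G \<theta> \<phi>) {u, v} x" if x: "x \<in> PiE {u, v} Y" for x
      proof -
        have "x = pair (x u) (x v)"
          using x ne by (auto simp: pair_def PiE_iff extensional_def fun_eq_iff)
        moreover have "m (x v) \<le> c (x u) (x v)"
          using x Y[OF u] unfolding m_def by (intro Min_le) auto
        ultimately show ?thesis
          using ne by (simp add: pairwise_reparam_edge \<phi>_def c_def)
      qed
      then show ?thesis
        using finite_labellings[OF less.prems(1), of "{u, v}"] u v by simp
    qed
    ultimately have "lagrange_dual G' Y \<theta>' \<phi>' \<le> lagrange_dual G Y \<theta> \<phi>"
      unfolding lagrange_dual_def sum_of_minima_def split_edges G'_simps(1) by simp
    with le \<open>energy G \<theta> y = energy G' \<theta>' y'\<close> y show ?thesis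
      by (intro exI[of _ \<phi>] bexI[of _ y]) auto
  qed
qed

text \<open>Weak duality gives one inequality. For the other, an optimal \<phi> does at least as
  well as the tight reparametrization of \<open>acyclic_dual_tight\<close>, whose dual value reaches
  the energy of some labelling.\<close>

lemma optimal_reparam_acyclic:
  assumes "graphical_model G Y" and "graph_acyclic G" and "optimal_reparam G Y \<theta> \<phi>"
  shows "lagrange_dual G Y \<theta> \<phi> = (MIN y\<in>PiE (verts G) Y. energy G \<theta> y)"
proof (rule antisym)
  have fin: "finite (PiE (verts G) Y)" "PiE (verts G) Y \<noteq> {}"
    using finite_labellings[OF assms(1)] by auto
  then show "lagrange_dual G Y \<theta> \<phi> \<le> (MIN y\<in>PiE (verts G) Y. energy G \<theta> y)"
    using lagrange_dual_le_energy[OF assms(1)] by simp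
  obtain \<phi>' y where "y \<in> PiE (verts G) Y" "energy G \<theta> y \<le> lagrange_dual G Y \<theta> \<phi>'"
    using acyclic_dual_tight[OF assms(1,2)] by blast
  moreover have "lagrange_dual G Y \<theta> \<phi>' \<le> lagrange_dual G Y \<theta> \<phi>"
    using assms(3) by (simp add: optimal_reparam_def)
  ultimately show "(MIN y\<in>PiE (verts G) Y. energy G \<theta> y) \<le> lagrange_dual G Y \<theta> \<phi>"
    using fin by (auto simp: Min_le_iff intro: order_trans)
qed

section \<open>Decompositions\<close>

text \<open>Since the slaves have disjoint edge sets covering \<open>edges G\<close>, the
  neighborhood of \<open>u\<close> in \<open>G\<close> is the disjoint union of its neighborhoods in
  the slaves containing \<open>u\<close>. The subtracted sums of \<phi> therefore split in the same
  way as the unary costs.\<close>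

lemma unary_reparam_decomposition:
  assumes "graphical_model G Y" and can: "canonical_decomposition G T H"
    and cost: "\<theta>T \<in> decomposed_costs G Y \<theta> T H" and u: "u \<in> verts G" and s: "s \<in> Y u"
  shows "unary (reparam G \<theta> \<phi>) u s =
    (\<Sum>\<tau> | \<tau> \<in> T \<and> u \<in> verts (H \<tau>). unary (reparam (H \<tau>) (\<theta>T \<tau>) \<phi>) u s)"
proof -
  let ?T = "{\<tau> \<in> T. u \<in> verts (H \<tau>)}"
  have finT: "finite T" and simple: "\<And>\<tau>. \<tau> \<in> T \<Longrightarrow> simple_graph (H \<tau>)"
    and E: "edges G = (\<Union>\<tau>\<in>T. edges (H \<tau>))"
    and disj: "\<And>\<tau> \<sigma>. \<tau> \<in> T \<Longrightarrow> \<sigma> \<in> T \<Longrightarrow> \<tau> \<noteq> \<sigma> \<Longrightarrow> edges (H \<tau>) \<inter> edges (H \<sigma>) = {}"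
    using can by (auto simp: canonical_decomposition_def decomposition_def subgraph_def)
  have "neighbors G u = (\<Union>\<tau>\<in>?T. neighbors (H \<tau>) u)"
    using simple_graph_edge_verts(1)[OF simple] by (auto simp: neighbors_def E)
  moreover have "(\<Sum>v\<in>(\<Union>\<tau>\<in>?T. neighbors (H \<tau>) u). \<phi> u v s) =
      (\<Sum>\<tau>\<in>?T. \<Sum>v\<in>neighbors (H \<tau>) u. \<phi> u v s)"
  proof (intro sum.UNION_disjoint ballI impI)
    fix \<tau> \<sigma> assume "\<tau> \<in> ?T" "\<sigma> \<in> ?T" "\<tau> \<noteq> \<sigma>"
    then show "neighbors (H \<tau>) u \<inter> neighbors (H \<sigma>) u = {}"
      using disj[of \<tau> \<sigma>] by (auto simp: neighbors_def)
  qed (use finT finite_neighbors[OF simple] in auto)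
  moreover have "(\<Sum>\<tau>\<in>?T. unary (\<theta>T \<tau>) u s) = unary \<theta> u s"
    using cost u s by (simp add: decomposed_costs_def)
  ultimately show ?thesis
    by (simp add: unary_reparam sum_subtractf)
qed

text \<open>Only one slave contains \<open>e\<close>, so the cost constraint at \<open>e\<close> has
  a single summand; the terms added by \<phi> depend on the edge alone and not on the graph.\<close>

lemma pairwise_reparam_decomposition:
  assumes can: "canonical_decomposition G T H"
    and cost: "\<theta>T \<in> decomposed_costs G Y \<theta> T H"
    and \<tau>: "\<tau> \<in> T" and e: "e \<in> edges (H \<tau>)" and x: "x \<in> PiE e Y"
  shows "pairwise (reparam G \<theta> \<phi>) e x = pairwise (reparam (H \<tau>) (\<theta>T \<tau>) \<phi>) e x"
proof -
  have "{\<sigma> \<in> T. e \<in> edges (H \<sigma>)} = {\<tau>}"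
    using can \<tau> e by (auto simp: canonical_decomposition_def)
  moreover have "e \<in> edges G"
    using can \<tau> e by (auto simp: canonical_decomposition_def decomposition_def)
  then have "(\<Sum>\<sigma> | \<sigma> \<in> T \<and> e \<in> edges (H \<sigma>). pairwise (\<theta>T \<sigma>) e x) = pairwise \<theta> e x"
    using cost x by (simp add: decomposed_costs_def)
  ultimately show ?thesis
    by (simp add: pairwise_reparam)
qed

theorem proposition9p10:
  fixes G :: "'v ugraph" and Y :: "'v \<Rightarrow> 'l set" and \<theta> :: "('v, 'l) cost"
    and T :: "'t set" and H :: "'t \<Rightarrow> 'v ugraph" and \<theta>T :: "'t \<Rightarrow> ('v, 'l) cost"
    and \<phi> :: "'v \<Rightarrow> 'v \<Rightarrow> 'l \<Rightarrow> real"
  assumes "graphical_model G Y"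
    and "canonical_decomposition G T H"
    and "\<theta>T \<in> decomposed_costs G Y \<theta> T H"
    and "\<And>\<tau>. \<tau> \<in> T \<Longrightarrow> optimal_reparam (H \<tau>) Y (\<theta>T \<tau>) \<phi>"
    and "\<And>\<tau> u s. \<tau> \<in> T \<Longrightarrow> u \<in> verts (H \<tau>) \<Longrightarrow> s \<in> Y u \<Longrightarrow>
           unary (reparam (H \<tau>) (\<theta>T \<tau>) \<phi>) u s = 0"
  shows "lagrange_dual G Y \<theta> \<phi> = decomposition_bound Y T H \<theta>T"
proof -
  have Y: "Y u \<noteq> {}" if "u \<in> verts G" for u
    using assms(1) that by (simp add: graphical_model_def)
  have finT: "finite T" and sub: "\<And>\<tau>. \<tau> \<in> T \<Longrightarrow> subgraph (H \<tau>) G"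
    and E: "edges G = (\<Union>\<tau>\<in>T. edges (H \<tau>))"
    and acyclic: "\<And>\<tau>. \<tau> \<in> T \<Longrightarrow> graph_acyclic (H \<tau>)"
    and disj: "\<And>\<tau> \<sigma>. \<tau> \<in> T \<Longrightarrow> \<sigma> \<in> T \<Longrightarrow> \<tau> \<noteq> \<sigma> \<Longrightarrow> edges (H \<tau>) \<inter> edges (H \<sigma>) = {}"
    using assms(2) by (auto simp: canonical_decomposition_def decomposition_def)
  have simple: "simple_graph (H \<tau>)" if "\<tau> \<in> T" for \<tau>
    using sub[OF that] by (simp add: subgraph_def)
  have model: "graphical_model (H \<tau>) Y" if "\<tau> \<in> T" for \<tau>
    using assms(1) sub[OF that] by (auto simp: graphical_model_def subgraph_def)
  define edge_min where
    "edge_min e = (MIN x\<in>PiE e Y. pairwise (reparam G \<theta> \<phi>) e x)" for e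
  \<comment> \<open>Nonempty label sets matter here: \<open>Min\<close> of the empty set is
    unspecified.\<close>
  have zero_min: "(MIN s\<in>Y u. f s) = 0" if "u \<in> verts G" "\<And>s. s \<in> Y u \<Longrightarrow> f s = 0"
    for u and f :: "'l \<Rightarrow> real"
    using that Y[OF that(1)] by (simp add: image_constant_conv cong: image_cong)

  have slave: "lagrange_dual (H \<tau>) Y (\<theta>T \<tau>) \<phi> = (\<Sum>e\<in>edges (H \<tau>). edge_min e)"
    if \<tau>: "\<tau> \<in> T" for \<tau>
  proof -
    have "(MIN s\<in>Y u. unary (reparam (H \<tau>) (\<theta>T \<tau>) \<phi>) u s) = 0" if "u \<in> verts (H \<tau>)" for u
      using that sub[OF \<tau>] assms(5)[OF \<tau>] by (intro zero_min) (auto simp: subgraph_def)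
    moreover have "(MIN x\<in>PiE e Y. pairwise (reparam (H \<tau>) (\<theta>T \<tau>) \<phi>) e x) = edge_min e"
      if "e \<in> edges (H \<tau>)" for e
      unfolding edge_min_def
      using pairwise_reparam_decomposition[OF assms(2,3) \<tau> that] by (simp cong: image_cong)
    ultimately show ?thesis
      by (simp add: lagrange_dual_def sum_of_minima_def)
  qed
  \<comment> \<open>In general the minimum of a sum only dominates the sum of the minima. Here
    equality holds because every slave summand at \<open>u\<close> vanishes identically.\<close>
  have "(MIN s\<in>Y u. unary (reparam G \<theta> \<phi>) u s) = 0" if "u \<in> verts G" for u
    using that assms(5)
    by (intro zero_min) (simp_all add: unary_reparam_decomposition[OF assms(1-3)])
  then have "lagrange_dual G Y \<theta> \<phi> = (\<Sum>e\<in>edges G. edge_min e)"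
    by (simp add: lagrange_dual_def sum_of_minima_def edge_min_def)
  also have "\<dots> = (\<Sum>\<tau>\<in>T. \<Sum>e\<in>edges (H \<tau>). edge_min e)"
    unfolding E using finT finite_edges[OF simple] disj by (intro sum.UNION_disjoint) auto
  \<comment> \<open>Optimality enters here: on each acyclic slave, the dual value, now a sum of edge
    minima, equals the minimal energy.\<close>
  also have "\<dots> = (\<Sum>\<tau>\<in>T. MIN y\<in>PiE (verts (H \<tau>)) Y. energy (H \<tau>) (\<theta>T \<tau>) y)"
    using slave optimal_reparam_acyclic[OF model acyclic assms(4)] by (intro sum.cong) auto
  finally show ?thesis
    by (simp add: decomposition_bound_def)
qed

end
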